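(* Let the input state of the circuit have particle number exactly $k$ (i.e. lie in the span of computational basis states of Hamming weight $k$), let the disjoint pairs of layer $\ell$ cover all $n$ modes, and let the real numbers $a_1,\dots,a_k$ and $r_1,\dots,r_k$ solve $$\sum_{q=1}^k a_q\sin(r_q)\cos(r_q)^{2m-1}=\tfrac12,\qquad m=1,\dots,k.$$ Let $M$ be any particle-number-preserving observable. Regard the loss $\mathcal L$ as a function of the RBS angles $\theta_\ell=(\theta_\ell^{(1)},\dots,\theta_\ell^{(n/2)})$ of layer $\ell$, all other parameters being fixed. Let $s=(s_1,\dots,s_{n/2})$ be uniform on $\{\pm1\}^{n/2}$ and define $$\hat g_j(s)=s_j\sum_{q=1}^k a_q\big[\mathcal L(\theta_\ell+r_qs)-\mathcal L(\theta_\ell-r_qs)\big].$$ Then for all $j\in\{1,\dots,n/2\}$ simultaneously $$\mathbb E_s[\hat g_j(s)]=\frac{\partial\mathcal L}{\partial\theta_\ell^{(j)}},$$ and for a given $s$ all the estimators $\hat g_1(s),\dots,\hat g_{n/2}(s)$ are computed from the same $2k$ evaluations of $\mathcal L$ in total ($k$ shifts, each evaluated at $\pm r_q$), independently of $n$. The covering hypothesis holds for every layer of the unitary butterfly and every column of the unitary brick-wall.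
   Context: $n$ even; qubits are called modes. The RBS gate on qubits $(i,j)$ is, in the basis $|00\rangle,|01\rangle,|10\rangle,|11\rangle$, $\mathrm{RBS}(\theta)=\begin{pmatrix}1&0&0&0\\0&\cos\theta&\sin\theta&0\\0&-\sin\theta&\cos\theta&0\\0&0&0&1\end{pmatrix}$; $R_z(\phi)=\mathrm{diag}(e^{i\phi/2},e^{-i\phi/2})$. The circuit is $U=U^{(K)}\cdots U^{(1)}$, with layers $U^{(\ell)}=\big[\bigotimes_{\text{pairs }j}\mathrm{RBS}(\theta_\ell^{(j)})\big]\bigotimes_{i=1}^nR_z(\phi_\ell^{(i)})$, the RBS gates of a layer acting on disjoint pairs of qubits. The loss is $\mathcal L=\langle\psi|U^\dagger MU|\psi\rangle$ for the input state $|\psi\rangle$. An observable $M$ (Hermitian operator) is particle-number preserving if it commutes with the total Hamming-weight operator. Unitary butterfly: $n=2^K$, layer $\ell=1,\dots,K$ pairs qubits whose binary labels differ exactly in bit $\ell-1$. Unitary brick-wall: $n$ columns; odd columns use pairs $(1,2),(3,4),\dots,(n-1,n)$, even columns $(2,3),\dots,(n-2,n-1),(n,1)$. *)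

theory Defs
  imports
    "HOL-Probability.Probability_Mass_Function"
    "Jordan_Normal_Form.Schur_Decomposition"
    "Jordan_Normal_Form.VS_Connect"
begin

text \<open>
  Qubits (modes) are numbered from 0. The state space of n qubits is the space of complex vectors
  of dimension \<open>2 ^ n\<close>; the basis vector with index x stands for the computational basis state in
  which qubit i is in state \<open>bit x i\<close>, so qubit 0 is the least significant bit of the index.
\<close>

definition rbs :: "real \<Rightarrow> complex mat" where
  "rbs \<theta> = mat_of_rows_list 4
     [[1, 0, 0, 0],
      [0, complex_of_real (cos \<theta>), complex_of_real (sin \<theta>), 0],
      [0, - complex_of_real (sin \<theta>), complex_of_real (cos \<theta>), 0],
      [0, 0, 0, 1]]"

definition rz :: "real \<Rightarrow> complex mat" where
  "rz \<phi> = mat_of_rows_list 2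
     [[exp (\<i> * complex_of_real \<phi> / 2), 0],
      [0, exp (- \<i> * complex_of_real \<phi> / 2)]]"

text \<open>
  \<open>on_qubit n i A\<close> and \<open>on_pair n (i, j) A\<close> are the operators on n qubits that act as A on the
  indicated qubits and as the identity on all others. For a pair, the rows and columns of A are
  ordered 00, 01, 10, 11 with the state of qubit i written first.
\<close>

definition on_qubit :: "nat \<Rightarrow> nat \<Rightarrow> complex mat \<Rightarrow> complex mat" where
  "on_qubit n i A = mat (2 ^ n) (2 ^ n) (\<lambda>(x, y).
     if \<forall>b<n. b \<noteq> i \<longrightarrow> bit x b = bit y b
     then A $$ (of_bool (bit x i), of_bool (bit y i)) else 0)"

definition on_pair :: "nat \<Rightarrow> nat \<times> nat \<Rightarrow> complex mat \<Rightarrow> complex mat" where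
  "on_pair n = (\<lambda>(i, j) A. mat (2 ^ n) (2 ^ n) (\<lambda>(x, y).
     if \<forall>b<n. b \<noteq> i \<and> b \<noteq> j \<longrightarrow> bit x b = bit y b
     then A $$ (2 * of_bool (bit x i) + of_bool (bit x j),
                2 * of_bool (bit y i) + of_bool (bit y j)) else 0))"

definition disjoint_pairs :: "nat \<Rightarrow> (nat \<times> nat) list \<Rightarrow> bool" where
  "disjoint_pairs n ps \<longleftrightarrow>
     (\<forall>(i, j) \<in> set ps. i < n \<and> j < n \<and> i \<noteq> j) \<and>
     (\<forall>p < length ps. \<forall>q < length ps. p \<noteq> q \<longrightarrow>
        {fst (ps ! p), snd (ps ! p)} \<inter> {fst (ps ! q), snd (ps ! q)} = {})"

definition covers_modes :: "nat \<Rightarrow> (nat \<times> nat) list \<Rightarrow> bool" where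
  "covers_modes n ps \<longleftrightarrow> (\<Union>(i, j) \<in> set ps. {i, j}) = {..<n}"

text \<open>
  The tensor products within a layer are products of commuting operators acting on disjoint sets
  of qubits, so the order of the factors is immaterial. The j-th pair of the list \<open>ps\<close> carries the
  angle \<open>\<theta> j\<close>, and qubit i carries the angle \<open>\<phi> i\<close>.
\<close>

definition rbs_layer :: "nat \<Rightarrow> (nat \<times> nat) list \<Rightarrow> (nat \<Rightarrow> real) \<Rightarrow> complex mat" where
  "rbs_layer n ps \<theta> =
     foldr (*) (map (\<lambda>j. on_pair n (ps ! j) (rbs (\<theta> j))) [0..<length ps]) (1\<^sub>m (2 ^ n))"

definition rz_layer :: "nat \<Rightarrow> (nat \<Rightarrow> real) \<Rightarrow> complex mat" where
  "rz_layer n \<phi> = foldr (*) (map (\<lambda>i. on_qubit n i (rz (\<phi> i))) [0..<n]) (1\<^sub>m (2 ^ n))"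

text \<open>Layers are numbered from 1: \<open>circuit n P \<theta> \<phi> d\<close> is the product of the layers \<open>d, \<dots>, 1\<close>.\<close>

primrec circuit ::
  "nat \<Rightarrow> (nat \<Rightarrow> (nat \<times> nat) list) \<Rightarrow> (nat \<Rightarrow> nat \<Rightarrow> real) \<Rightarrow> (nat \<Rightarrow> nat \<Rightarrow> real) \<Rightarrow> nat \<Rightarrow> complex mat"
where
  "circuit n P \<theta> \<phi> 0 = 1\<^sub>m (2 ^ n)"
| "circuit n P \<theta> \<phi> (Suc d) =
     (rbs_layer n (P (Suc d)) (\<theta> (Suc d)) * rz_layer n (\<phi> (Suc d))) * circuit n P \<theta> \<phi> d"

text \<open>
  The operator \<open>\<bullet>c\<close> is conjugate-linear in its second argument. The expectation value of a Hermitian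
  operator is real, so \<open>Re\<close> only changes the type.
\<close>

definition loss ::
  "nat \<Rightarrow> (nat \<Rightarrow> (nat \<times> nat) list) \<Rightarrow> nat \<Rightarrow> complex vec \<Rightarrow> complex mat \<Rightarrow>
   (nat \<Rightarrow> nat \<Rightarrow> real) \<Rightarrow> (nat \<Rightarrow> nat \<Rightarrow> real) \<Rightarrow> real"
where
  "loss n P d \<psi> M \<theta> \<phi> =
     (let U = circuit n P \<theta> \<phi> d in Re (((mat_adjoint U * M * U) *\<^sub>v \<psi>) \<bullet>c \<psi>))"

definition hamming_weight :: "nat \<Rightarrow> nat \<Rightarrow> nat" where
  "hamming_weight n x = card {i. i < n \<and> bit x i}"

definition weight_operator :: "nat \<Rightarrow> complex mat" where
  "weight_operator n = mat (2 ^ n) (2 ^ n) (\<lambda>(x, y). if x = y then of_nat (hamming_weight n x) else 0)"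

definition observable :: "nat \<Rightarrow> complex mat \<Rightarrow> bool" where
  "observable n M \<longleftrightarrow> M \<in> carrier_mat (2 ^ n) (2 ^ n) \<and> mat_adjoint M = M"

definition particle_number_preserving :: "nat \<Rightarrow> complex mat \<Rightarrow> bool" where
  "particle_number_preserving n M \<longleftrightarrow> M * weight_operator n = weight_operator n * M"

definition weight_space :: "nat \<Rightarrow> nat \<Rightarrow> complex vec set" where
  "weight_space n k =
     LinearCombinations.module.span class_ring (module_vec TYPE(complex) (2 ^ n))
       {unit_vec (2 ^ n) x | x. x < 2 ^ n \<and> hamming_weight n x = k}"

definition quantum_state :: "nat \<Rightarrow> complex vec \<Rightarrow> bool" where
  "quantum_state n \<psi> \<longleftrightarrow> \<psi> \<in> carrier_vec (2 ^ n) \<and> \<psi> \<bullet>c \<psi> = 1"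

definition sign_vectors :: "nat \<Rightarrow> (nat \<Rightarrow> real) set" where
  "sign_vectors N = {..<N} \<rightarrow>\<^sub>E {-1, 1}"

definition estimator ::
  "nat \<Rightarrow> (nat \<Rightarrow> real) \<Rightarrow> (nat \<Rightarrow> real) \<Rightarrow> ((nat \<Rightarrow> real) \<Rightarrow> real) \<Rightarrow> (nat \<Rightarrow> real) \<Rightarrow>
   (nat \<Rightarrow> real) \<Rightarrow> nat \<Rightarrow> real"
where
  "estimator k a r L v s j =
     s j * (\<Sum>q=1..k. a q * (L (\<lambda>i. v i + r q * s i) - L (\<lambda>i. v i - r q * s i)))"

definition evaluation_points ::
  "nat \<Rightarrow> (nat \<Rightarrow> real) \<Rightarrow> (nat \<Rightarrow> real) \<Rightarrow> (nat \<Rightarrow> real) \<Rightarrow> (nat \<Rightarrow> real) list"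
where
  "evaluation_points k r v s =
     concat (map (\<lambda>q. [\<lambda>i. v i + r q * s i, \<lambda>i. v i - r q * s i]) [1..<Suc k])"

definition butterfly_pairs :: "nat \<Rightarrow> nat \<Rightarrow> (nat \<times> nat) list" where
  "butterfly_pairs K l =
     filter (\<lambda>(i, j). i < j \<and> (\<forall>b. bit i b \<noteq> bit j b \<longleftrightarrow> b = l - 1))
       (List.product [0..<2 ^ K] [0..<2 ^ K])"

text \<open>
  Columns are numbered from 1 and qubits from 0, so \<open>(1, 2), (3, 4), \<dots>\<close> with qubits numbered from 1
  becomes \<open>(0, 1), (2, 3), \<dots>\<close>, and the wrap-around pair \<open>(n, 1)\<close> becomes \<open>(n - 1, 0)\<close>.
\<close>

definition brick_wall_pairs :: "nat \<Rightarrow> nat \<Rightarrow> (nat \<times> nat) list" where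
  "brick_wall_pairs n c =
     (if odd c then map (\<lambda>j. (2 * j, 2 * j + 1)) [0..<n div 2]
      else map (\<lambda>j. (2 * j + 1, (2 * j + 2) mod n)) [0..<n div 2])"

end

theory Submission
  imports Defs
begin

text \<open>
  Fix the layer and let v be its angles. A column x of the RBS layer is, in each variable
  \<open>v\<^sub>j\<close>, constant if x has equal bits on pair j and linear in \<open>cos v\<^sub>j\<close>, \<open>sin v\<^sub>j\<close>
  otherwise. Hence the loss is a sum of products \<open>\<Prod>\<^sub>j g\<^sub>j(v\<^sub>j)\<close>, where the degrees of the factors add
  up to the number of pairs on which x or y (two basis states of weight k, counted separately) is
  unbalanced. As the pairs cover all modes, each of these two numbers is at most k and has the
  parity of k, so the total degree is even and at most \<open>2 k\<close>.

  Write \<open>g\<^sub>j(v\<^sub>j + t) = A\<^sub>j(cos t) + sin t D\<^sub>j(cos t)\<close>. Averaging over independent signs keeps \<open>D\<^sub>j\<close> for the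
  selected j and \<open>A\<^sub>i\<close> for all other i, so the expected central difference for the shift r is
  \<open>2 sin r p(cos r)\<close> with \<open>p = D\<^sub>j \<Prod>\<^bsub>i \<noteq> j\<^esub> A\<^sub>i\<close>, an odd polynomial of degree below \<open>2 k\<close>, and
  the partial derivative is \<open>p(1)\<close>. The moment equations say exactly that the weights a recover
  \<open>p(1)\<close> from these differences.
\<close>

unbundle no vec_syntax

subsection \<open>Trigonometric polynomials and random sign shifts\<close>

text \<open>Parity is tracked along with the degree because the moment equations control only odd
  powers of \<open>cos (r q)\<close>.\<close>

definition parity_bounded :: "nat \<Rightarrow> real poly \<Rightarrow> bool" where
  "parity_bounded e p \<longleftrightarrow> (\<forall>i. coeff p i \<noteq> 0 \<longrightarrow> i \<le> e \<and> even (e + i))"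

lemma parity_bounded_add:
  "parity_bounded e p \<Longrightarrow> parity_bounded e q \<Longrightarrow> parity_bounded e (p + q)"
  unfolding parity_bounded_def by (metis add.right_neutral coeff_add)

lemma parity_bounded_minus: "parity_bounded e p \<Longrightarrow> parity_bounded e (- p)"
  unfolding parity_bounded_def by simp

lemma parity_bounded_mult:
  assumes "parity_bounded e p" "parity_bounded f q"
  shows "parity_bounded (e + f) (p * q)"
  unfolding parity_bounded_def
proof (intro allI impI)
  fix m assume "coeff (p * q) m \<noteq> 0"
  then obtain i where i: "i \<le> m" "coeff p i \<noteq> 0" "coeff q (m - i) \<noteq> 0"
    unfolding coeff_mult by (metis (no_types, lifting) atMost_iff mult_eq_0_iff sum.neutral)
  then have "i \<le> e" "even (e + i)" "m - i \<le> f" "even (f + (m - i))"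
    using assms unfolding parity_bounded_def by blast+
  then show "m \<le> e + f \<and> even (e + f + m)"
    using i(1) by (auto simp: even_add)
qed

lemma parity_bounded_one: "parity_bounded 0 1"
  by (auto simp: parity_bounded_def split: if_splits)

lemma parity_bounded_prod:
  assumes "finite I" "\<And>i. i \<in> I \<Longrightarrow> parity_bounded (e i) (p i)"
  shows "parity_bounded (\<Sum>i\<in>I. e i) (\<Prod>i\<in>I. p i)"
  using assms by (induction rule: finite_induct) (auto intro: parity_bounded_one parity_bounded_mult)

text \<open>For a product of two sine parts the bound comes from
  \<open>pCons 0 D * pCons 0 E\<close>; this recovers the bound for \<open>D * E\<close>
  itself.\<close>

lemma parity_bounded_shift_down:
  assumes "parity_bounded e (pCons 0 (pCons 0 p))"
  shows "parity_bounded e p"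
  unfolding parity_bounded_def
proof (intro allI impI)
  fix i assume "coeff p i \<noteq> 0"
  then have "coeff (pCons 0 (pCons 0 p)) (Suc (Suc i)) \<noteq> 0" by simp
  then have "Suc (Suc i) \<le> e \<and> even (e + Suc (Suc i))"
    using assms unfolding parity_bounded_def by blast
  then show "i \<le> e \<and> even (e + i)" by auto
qed

\<comment> \<open>The condition on \<open>pCons 0 D\<close> bounds D by degree \<open>e - 1\<close> without truncated subtraction, so
  \<open>D = 0\<close> if \<open>e = 0\<close>.\<close>
definition trig :: "nat \<Rightarrow> (real \<Rightarrow> real) \<Rightarrow> bool" where
  "trig e g \<longleftrightarrow> (\<forall>v. \<exists>A D. parity_bounded e A \<and> parity_bounded e (pCons 0 D) \<and>
     (\<forall>t. g (v + t) = poly A (cos t) + sin t * poly D (cos t)))"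

lemma trig_const: "trig 0 (\<lambda>_. c)"
  unfolding trig_def
  by (intro allI exI[of _ "[:c:]"] exI[of _ 0])
     (auto simp: parity_bounded_def coeff_pCons split: nat.splits)

lemma trig_cos: "trig 1 cos"
  unfolding trig_def
proof
  fix v :: real
  show "\<exists>A D. parity_bounded 1 A \<and> parity_bounded 1 (pCons 0 D) \<and>
     (\<forall>t. cos (v + t) = poly A (cos t) + sin t * poly D (cos t))"
    by (intro exI[of _ "[:0, cos v:]"] exI[of _ "[:- sin v:]"])
       (auto simp: parity_bounded_def cos_add coeff_pCons split: nat.splits)
qed

lemma trig_sin: "trig 1 sin"
  unfolding trig_def
proof
  fix v :: real
  show "\<exists>A D. parity_bounded 1 A \<and> parity_bounded 1 (pCons 0 D) \<and>
     (\<forall>t. sin (v + t) = poly A (cos t) + sin t * poly D (cos t))"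
    by (intro exI[of _ "[:0, sin v:]"] exI[of _ "[:cos v:]"])
       (auto simp: parity_bounded_def sin_add coeff_pCons split: nat.splits)
qed

lemma trig_minus:
  assumes "trig e g"
  shows "trig e (\<lambda>t. - g t)"
  unfolding trig_def
proof
  fix v
  obtain A D where "parity_bounded e A" "parity_bounded e (pCons 0 D)"
    "\<And>t. g (v + t) = poly A (cos t) + sin t * poly D (cos t)"
    using assms unfolding trig_def by metis
  then show "\<exists>A D. parity_bounded e A \<and> parity_bounded e (pCons 0 D) \<and>
     (\<forall>t. - g (v + t) = poly A (cos t) + sin t * poly D (cos t))"
    by (intro exI[of _ "- A"] exI[of _ "- D"])
       (auto dest: parity_bounded_minus)
qed

lemma trig_zero: "trig e (\<lambda>_. 0)"
  unfolding trig_def by (intro allI exI[of _ 0]) (simp add: parity_bounded_def)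

lemma trig_mult:
  assumes "trig e g" "trig f h"
  shows "trig (e + f) (\<lambda>t. g t * h t)"
  unfolding trig_def
proof
  fix v
  obtain A D where g: "parity_bounded e A" "parity_bounded e (pCons 0 D)"
    "\<And>t. g (v + t) = poly A (cos t) + sin t * poly D (cos t)"
    using assms(1) unfolding trig_def by metis
  obtain B E where h: "parity_bounded f B" "parity_bounded f (pCons 0 E)"
    "\<And>t. h (v + t) = poly B (cos t) + sin t * poly E (cos t)"
    using assms(2) unfolding trig_def by metis
  \<comment> \<open>\<open>sin\<^sup>2 t = 1 - cos\<^sup>2 t\<close> turns the product of the sine parts into a polynomial in \<open>cos t\<close>.\<close>
  define A' where "A' = A * B + (D * E + - (pCons 0 D * pCons 0 E))"
  define D' where "D' = A * E + D * B"
  have DE: "parity_bounded (e + f) (pCons 0 D * pCons 0 E)"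
    using g h by (intro parity_bounded_mult)
  then have DE': "parity_bounded (e + f) (D * E)"
    using parity_bounded_shift_down by simp
  have "parity_bounded (e + f) A'"
    unfolding A'_def
    by (intro parity_bounded_add parity_bounded_minus DE DE' parity_bounded_mult[OF g(1) h(1)])
  \<comment> \<open>The extra factor of the variable goes, in each summand, to the polynomial that
    carried the sine.\<close>
  moreover have "pCons 0 D' = A * pCons 0 E + pCons 0 D * B"
    unfolding D'_def by simp
  then have "parity_bounded (e + f) (pCons 0 D')"
    using g h by (auto intro!: parity_bounded_add parity_bounded_mult simp del: mult_pCons_left mult_pCons_right)
  moreover have "g (v + t) * h (v + t) = poly A' (cos t) + sin t * poly D' (cos t)" for t
  proof -
    have "sin t * sin t = 1 - cos t * cos t"
      using sin_cos_squared_add[of t] by (simp add: power2_eq_square)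
    then have "sin t * sin t * x = x - cos t * cos t * x" for x
      by (simp add: left_diff_distrib)
    note * = this[of "poly D (cos t) * poly E (cos t)"]
    show ?thesis
      unfolding g(3) h(3) A'_def D'_def using * by (simp add: algebra_simps)
  qed
  ultimately show "\<exists>A D. parity_bounded (e + f) A \<and> parity_bounded (e + f) (pCons 0 D) \<and>
     (\<forall>t. g (v + t) * h (v + t) = poly A (cos t) + sin t * poly D (cos t))" by blast
qed

text \<open>Degrees are recorded per variable so that two such functions multiply factor by factor;
  the shift rule looks only at their sum. Scalar multiples are left to
  \<open>exact_shift_rule_cmult\<close>.\<close>

inductive trig_span :: "nat \<Rightarrow> (nat \<Rightarrow> nat) \<Rightarrow> ((nat \<Rightarrow> real) \<Rightarrow> real) \<Rightarrow> bool" for N e where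
  trig_span_prod: "(\<And>i. i < N \<Longrightarrow> trig (e i) (g i)) \<Longrightarrow> trig_span N e (\<lambda>v. \<Prod>i<N. g i (v i))"
| trig_span_zero: "trig_span N e (\<lambda>_. 0)"
| trig_span_add: "trig_span N e F \<Longrightarrow> trig_span N e G \<Longrightarrow> trig_span N e (\<lambda>v. F v + G v)"

lemma trig_span_sum:
  assumes "finite I" "\<And>i. i \<in> I \<Longrightarrow> trig_span N e (F i)"
  shows "trig_span N e (\<lambda>v. \<Sum>i\<in>I. F i v)"
  using assms by (induction rule: finite_induct) (auto intro: trig_span_zero trig_span_add)

text \<open>Nested induction over both spans distributes the product down to two pure products,
  where \<open>trig_mult\<close> applies in each variable.\<close>

lemma trig_span_mult:
  assumes "trig_span N e F" "trig_span N f G"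
  shows "trig_span N (\<lambda>i. e i + f i) (\<lambda>v. F v * G v)"
  using assms(1)
proof (induction rule: trig_span.induct)
  case (trig_span_prod g)
  show ?case using assms(2)
  proof (induction rule: trig_span.induct)
    case (trig_span_prod h)
    have "trig_span N (\<lambda>i. e i + f i) (\<lambda>v. \<Prod>i<N. g i (v i) * h i (v i))"
      by (rule trig_span.trig_span_prod) (intro trig_mult trig_span_prod \<open>\<And>i. i < N \<Longrightarrow> trig (e i) (g i)\<close>)
    then show ?case by (simp add: prod.distrib)
  qed (auto simp: distrib_left intro: trig_span.intros)
qed (auto simp: distrib_right intro: trig_span.intros)

text \<open>The expectation appears here as a finite average over the \<open>2 ^ N\<close> sign
  vectors. The property is linear in \<open>F\<close>, so it passes from products to their linear
  combinations.\<close>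

definition exact_shift_rule ::
  "nat \<Rightarrow> nat \<Rightarrow> (nat \<Rightarrow> real) \<Rightarrow> (nat \<Rightarrow> real) \<Rightarrow> ((nat \<Rightarrow> real) \<Rightarrow> real) \<Rightarrow> bool"
where
  "exact_shift_rule N k a r F \<longleftrightarrow> (\<forall>v. \<forall>j<N.
     ((\<lambda>t. F (v(j := t))) has_real_derivative
        (\<Sum>s\<in>sign_vectors N. estimator k a r F v s j) / 2 ^ N) (at (v j)))"

lemma exact_shift_rule_zero: "exact_shift_rule N k a r (\<lambda>_. 0)"
  by (simp add: exact_shift_rule_def estimator_def)

lemma exact_shift_rule_cmult:
  assumes "exact_shift_rule N k a r F"
  shows "exact_shift_rule N k a r (\<lambda>v. c * F v)"
proof -
  have "estimator k a r (\<lambda>v. c * F v) v s j = c * estimator k a r F v s j" for v s j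
    by (simp add: estimator_def sum_distrib_left algebra_simps)
  then show ?thesis
    using assms unfolding exact_shift_rule_def
    by (auto simp: sum_distrib_left[symmetric] simp flip: times_divide_eq_right intro!: DERIV_cmult)
qed

lemma exact_shift_rule_add:
  assumes "exact_shift_rule N k a r F" "exact_shift_rule N k a r G"
  shows "exact_shift_rule N k a r (\<lambda>v. F v + G v)"
proof -
  have "estimator k a r (\<lambda>v. F v + G v) v s j = estimator k a r F v s j + estimator k a r G v s j" for v s j
    by (simp add: estimator_def sum.distrib sum_subtractf algebra_simps)
  then show ?thesis
    using assms unfolding exact_shift_rule_def
    by (auto simp: sum.distrib add_divide_distrib intro!: DERIV_add)
qed

lemma exact_shift_rule_sum:
  assumes "finite I" "\<And>i. i \<in> I \<Longrightarrow> exact_shift_rule N k a r (F i)"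
  shows "exact_shift_rule N k a r (\<lambda>v. \<Sum>i\<in>I. F i v)"
  using assms
  by (induction rule: finite_induct) (auto intro: exact_shift_rule_zero exact_shift_rule_add)

text \<open>Since \<open>E\<close> is even, only odd powers below \<open>2 * k\<close> occur in
  \<open>p\<close>. Each of them is \<open>2 * m - 1\<close> for some \<open>m\<close> in
  \<open>{1..k}\<close>, so the moment equations apply monomial by monomial, and the coefficients
  add up to \<open>poly p 1\<close>.\<close>

lemma moments_imp_poly:
  fixes a r :: "nat \<Rightarrow> real"
  assumes moments: "\<forall>m\<in>{1..k}. (\<Sum>q=1..k. a q * sin (r q) * cos (r q) ^ (2 * m - 1)) = 1 / 2"
    and p: "parity_bounded E (pCons 0 p)" and E: "even E" "E \<le> 2 * k"
  shows "(\<Sum>q=1..k. a q * sin (r q) * poly p (cos (r q))) = poly p 1 / 2"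
proof -
  have c: "coeff p i * (\<Sum>q=1..k. a q * sin (r q) * cos (r q) ^ i) = coeff p i / 2" for i
  proof (cases "coeff p i = 0")
    case False
    then have "coeff (pCons 0 p) (Suc i) \<noteq> 0" by simp
    then have "Suc i \<le> E" "even (E + Suc i)"
      using p unfolding parity_bounded_def by blast+
    then obtain m where m: "Suc i = 2 * m"
      using E(1) by (metis even_add evenE)
    then have "m \<in> {1..k}" "i = 2 * m - 1"
      using E(2) \<open>Suc i \<le> E\<close> by auto
    moreover from this(1) have "(\<Sum>q=1..k. a q * sin (r q) * cos (r q) ^ (2 * m - 1)) = 1 / 2"
      using moments by blast
    ultimately show ?thesis by simp
  qed simp
  have "(\<Sum>q=1..k. a q * sin (r q) * poly p (cos (r q)))
      = (\<Sum>q=1..k. \<Sum>i\<le>degree p. coeff p i * (a q * sin (r q) * cos (r q) ^ i))"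
    by (simp add: poly_altdef sum_distrib_left algebra_simps)
  also have "\<dots> = (\<Sum>i\<le>degree p. coeff p i * (\<Sum>q=1..k. a q * sin (r q) * cos (r q) ^ i))"
    by (subst sum.swap) (simp add: sum_distrib_left)
  also have "\<dots> = poly p 1 / 2"
    unfolding c by (simp add: poly_altdef sum_divide_distrib)
  finally show ?thesis .
qed

lemma exact_shift_rule_prod:
  assumes moments: "\<forall>m\<in>{1..k}. (\<Sum>q=1..k. a q * sin (r q) * cos (r q) ^ (2 * m - 1)) = 1 / 2"
    and g: "\<And>i. i < N \<Longrightarrow> trig (e i) (g i)"
    and e: "even (\<Sum>i<N. e i)" "(\<Sum>i<N. e i) \<le> 2 * k"
  shows "exact_shift_rule N k a r (\<lambda>v. \<Prod>i<N. g i (v i))"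
  unfolding exact_shift_rule_def
proof (intro allI impI)
  fix v :: "nat \<Rightarrow> real" and j assume j: "j < N"
  have "\<forall>i\<in>{..<N}. \<exists>A D. parity_bounded (e i) A \<and> parity_bounded (e i) (pCons 0 D) \<and>
     (\<forall>t. g i (v i + t) = poly A (cos t) + sin t * poly D (cos t))"
    using g unfolding trig_def by blast
  then obtain A D where A: "\<And>i. i < N \<Longrightarrow> parity_bounded (e i) (A i)"
    and D: "\<And>i. i < N \<Longrightarrow> parity_bounded (e i) (pCons 0 (D i))"
    and gAD: "\<And>i t. i < N \<Longrightarrow> g i (v i + t) = poly (A i) (cos t) + sin t * poly (D i) (cos t)"
    by (metis lessThan_iff)
  define p where "p = D j * (\<Prod>i\<in>{..<N} - {j}. A i)"
  have "parity_bounded (e j + (\<Sum>i\<in>{..<N} - {j}. e i)) (pCons 0 (D j) * (\<Prod>i\<in>{..<N} - {j}. A i))"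
    using A D j by (intro parity_bounded_mult parity_bounded_prod) auto
  moreover have "e j + (\<Sum>i\<in>{..<N} - {j}. e i) = (\<Sum>i<N. e i)"
    using j by (simp add: sum.remove)
  ultimately have p: "parity_bounded (\<Sum>i<N. e i) (pCons 0 p)"
    by (simp add: p_def)

  \<comment> \<open>\<open>S\<close> treats one signed shift: \<open>S (r q)\<close> and
    \<open>S (- r q)\<close> are the two halves of the central difference.\<close>
  define S where "S x = (\<Sum>s\<in>sign_vectors N. s j * (\<Prod>i<N. g i (v i + x * s i)))" for x
  have S: "S x = 2 ^ N * (sin x * poly p (cos x))" for x
  proof -
    \<comment> \<open>Absorbing the sign \<open>s j\<close> into the factor at \<open>j\<close>
      makes the summand a product over coordinates, so the sum over sign vectors factorizes.\<close>
    define f where "f i y = (if i = j then y else 1) * g i (v i + x * y)" for i y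
    have "s j * (\<Prod>i<N. g i (v i + x * s i)) = (\<Prod>i<N. f i (s i))" for s
      unfolding f_def prod.distrib using j by simp
    then have "S x = (\<Sum>s\<in>sign_vectors N. \<Prod>i<N. f i (s i))"
      by (simp add: S_def)
    also have "\<dots> = (\<Prod>i<N. \<Sum>y\<in>{-1, 1}. f i y)"
      unfolding sign_vectors_def by (rule prod_sum_PiE[symmetric]) auto
    also have "\<dots> = (\<Sum>y\<in>{-1, 1}. f j y) * (\<Prod>i\<in>{..<N} - {j}. \<Sum>y\<in>{-1, 1}. f i y)"
      using j by (simp add: prod.remove)
    \<comment> \<open>Passing from \<open>x\<close> to \<open>- x\<close> keeps the cosine and flips
      the sine. The extra sign at \<open>j\<close> cancels the \<open>A\<close> part; at the other
      coordinates, without that sign, the \<open>D\<close> part cancels.\<close>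
    also have "(\<Sum>y\<in>{-1, 1}. f j y) = 2 * (sin x * poly (D j) (cos x))"
      using gAD[OF j, of x] gAD[OF j, of "- x"] by (simp add: f_def)
    also have "(\<Prod>i\<in>{..<N} - {j}. \<Sum>y\<in>{-1, 1}. f i y) = (\<Prod>i\<in>{..<N} - {j}. 2 * poly (A i) (cos x))"
    proof (rule prod.cong)
      fix i assume "i \<in> {..<N} - {j}"
      then show "(\<Sum>y\<in>{-1, 1}. f i y) = 2 * poly (A i) (cos x)"
        using gAD[of i x] gAD[of i "- x"] by (simp add: f_def)
    qed simp
    \<comment> \<open>Coordinate \<open>j\<close> supplies the factor of two missing from
      \<open>2 ^ (N - 1)\<close>; as \<open>j < N\<close>, the subtraction does not
      truncate.\<close>
    also have "\<dots> = 2 ^ (N - 1) * poly (\<Prod>i\<in>{..<N} - {j}. A i) (cos x)"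
      using j by (simp add: prod.distrib poly_prod card_Diff_singleton)
    finally show ?thesis
      using j by (cases N) (simp_all add: p_def algebra_simps)
  qed
  have "(\<Sum>s\<in>sign_vectors N. estimator k a r (\<lambda>v. \<Prod>i<N. g i (v i)) v s j)
      = (\<Sum>s\<in>sign_vectors N. \<Sum>q=1..k. a q *
           (s j * (\<Prod>i<N. g i (v i + r q * s i)) - s j * (\<Prod>i<N. g i (v i + (- r q) * s i))))"
    unfolding estimator_def sum_distrib_left by (intro sum.cong refl) (simp add: algebra_simps)
  also have "\<dots> = (\<Sum>q=1..k. a q * (S (r q) - S (- r q)))"
    by (subst sum.swap) (simp add: S_def sum_distrib_left sum_subtractf right_diff_distrib)
  \<comment> \<open>\<open>S\<close> is odd in its argument, so the difference doubles it.\<close>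
  also have "\<dots> = 2 ^ N * 2 * (\<Sum>q=1..k. a q * sin (r q) * poly p (cos (r q)))"
    unfolding S sum_distrib_left by (intro sum.cong refl) (simp add: algebra_simps)
  also have "\<dots> = 2 ^ N * poly p 1"
    using moments_imp_poly[OF moments p e] by simp
  finally have est: "(\<Sum>s\<in>sign_vectors N. estimator k a r (\<lambda>v. \<Prod>i<N. g i (v i)) v s j) / 2 ^ N = poly p 1"
    by simp

  have prod_upd: "(\<Prod>i<N. g i ((v(j := t)) i)) = g j t * (\<Prod>i\<in>{..<N} - {j}. g i (v i))" for t
    using j by (simp add: prod.remove)
  \<comment> \<open>Recentring the expansion at \<open>v j\<close> gives a formula that can be
    differentiated. At zero shift the cosine has derivative 0 and the sine has derivative 1, which
    leaves \<open>poly (D j) 1\<close>.\<close>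
  have gj: "g j = (\<lambda>t. poly (A j) (cos (t - v j)) + sin (t - v j) * poly (D j) (cos (t - v j)))"
    using gAD[OF j, of "t - v j" for t] by auto
  have "(g j has_real_derivative poly (D j) 1) (at (v j))"
    unfolding gj by (auto intro!: derivative_eq_intros)
  then have "((\<lambda>t. \<Prod>i<N. g i ((v(j := t)) i)) has_real_derivative
      poly (D j) 1 * (\<Prod>i\<in>{..<N} - {j}. g i (v i))) (at (v j))"
    unfolding prod_upd by (rule DERIV_cmult_right)
  moreover have "(\<Prod>i\<in>{..<N} - {j}. g i (v i)) = (\<Prod>i\<in>{..<N} - {j}. poly (A i) 1)"
    using gAD[of _ 0] by (intro prod.cong) auto
  ultimately show "((\<lambda>t. \<Prod>i<N. g i ((v(j := t)) i)) has_real_derivative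
      (\<Sum>s\<in>sign_vectors N. estimator k a r (\<lambda>v. \<Prod>i<N. g i (v i)) v s j) / 2 ^ N) (at (v j))"
    unfolding est by (simp add: p_def poly_prod)
qed

lemma trig_span_imp_exact_shift_rule:
  assumes "\<forall>m\<in>{1..k}. (\<Sum>q=1..k. a q * sin (r q) * cos (r q) ^ (2 * m - 1)) = 1 / 2"
    and "even (\<Sum>i<N. e i)" "(\<Sum>i<N. e i) \<le> 2 * k"
    and "trig_span N e F"
  shows "exact_shift_rule N k a r F"
  using assms(4)
proof (induction rule: trig_span.induct)
  case (trig_span_prod g)
  then show ?case by (rule exact_shift_rule_prod[OF assms(1) _ assms(2,3)])
qed (auto intro: exact_shift_rule_zero exact_shift_rule_add)

subsection \<open>Entries of the circuit\<close>

lemma hamming_weight_eq_sum: "hamming_weight n x = (\<Sum>b<n. of_bool (bit x b))"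
proof -
  have "{i. i < n \<and> bit x i} = {b \<in> {..<n}. bit x b}" by auto
  then show ?thesis by (simp add: hamming_weight_def sum.If_cases of_bool_def Int_def)
qed

text \<open>This is the degree in the angle of pair \<open>j\<close> of the column \<open>x\<close>
  of an RBS layer; it is a natural number so that it can serve directly as the argument of
  \<open>trig\<close>.\<close>

definition odd_pair :: "(nat \<times> nat) list \<Rightarrow> nat \<Rightarrow> nat \<Rightarrow> nat" where
  "odd_pair ps x j = of_bool (bit x (fst (ps ! j)) \<noteq> bit x (snd (ps ! j)))"

text \<open>Disjointness and covering make the pairs a partition of the modes. The covering
  hypothesis enters the degree count through this lemma.\<close>

lemma sum_over_pairs:
  fixes f :: "nat \<Rightarrow> nat"
  assumes "disjoint_pairs n ps" "covers_modes n ps"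
  shows "(\<Sum>b<n. f b) = (\<Sum>j<length ps. f (fst (ps ! j)) + f (snd (ps ! j)))"
proof -
  have "{..<n} = (\<Union>j<length ps. {fst (ps ! j), snd (ps ! j)})"
    using assms(2) by (auto simp: covers_modes_def set_conv_nth split_beta)
  then have "(\<Sum>b<n. f b) = (\<Sum>j<length ps. \<Sum>b\<in>{fst (ps ! j), snd (ps ! j)}. f b)"
    using assms(1) by (simp only:) (rule sum.UNION_disjoint, auto simp: disjoint_pairs_def)
  also have "\<dots> = (\<Sum>j<length ps. f (fst (ps ! j)) + f (snd (ps ! j)))"
  proof (intro sum.cong refl)
    fix j assume "j \<in> {..<length ps}"
    then have "ps ! j \<in> set ps" by simp
    then have "fst (ps ! j) \<noteq> snd (ps ! j)"
      using assms(1) by (auto simp: disjoint_pairs_def split_beta)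
    then show "(\<Sum>b\<in>{fst (ps ! j), snd (ps ! j)}. f b) = f (fst (ps ! j)) + f (snd (ps ! j))"
      by simp
  qed
  finally show ?thesis .
qed

lemma length_covering_pairs:
  assumes "disjoint_pairs n ps" "covers_modes n ps"
  shows "length ps = n div 2"
  using sum_over_pairs[OF assms, of "\<lambda>_. 1"] by simp

text \<open>A pair contributes 0, 1 or 2 to the Hamming weight and is unbalanced exactly when it
  contributes 1; both claims follow pair by pair.\<close>

lemma sum_odd_pair:
  assumes "disjoint_pairs n ps" "covers_modes n ps"
  shows "(\<Sum>j<length ps. odd_pair ps x j) \<le> hamming_weight n x"
    and "even ((\<Sum>j<length ps. odd_pair ps x j) + hamming_weight n x)"
proof -
  let ?b = "\<lambda>j. of_bool (bit x (fst (ps ! j))) + of_bool (bit x (snd (ps ! j))) :: nat"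
  have hw: "hamming_weight n x = (\<Sum>j<length ps. ?b j)"
    unfolding hamming_weight_eq_sum by (rule sum_over_pairs[OF assms])
  show "(\<Sum>j<length ps. odd_pair ps x j) \<le> hamming_weight n x"
    unfolding hw by (intro sum_mono) (auto simp: odd_pair_def)
  have "even (\<Sum>j<length ps. odd_pair ps x j + ?b j)"
    by (intro dvd_sum) (auto simp: odd_pair_def)
  then show "even ((\<Sum>j<length ps. odd_pair ps x j) + hamming_weight n x)"
    unfolding hw by (simp add: sum.distrib)
qed

text \<open>Entrywise form of commuting with the weight operator, that is, block diagonality by
  Hamming weight; in this form it can be read off from gates and followed through products.\<close>

definition weight_preserving :: "nat \<Rightarrow> complex mat \<Rightarrow> bool" where
  "weight_preserving n A \<longleftrightarrow> A \<in> carrier_mat (2 ^ n) (2 ^ n) \<and>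
     (\<forall>x<2 ^ n. \<forall>y<2 ^ n. A $$ (x, y) \<noteq> 0 \<longrightarrow> hamming_weight n x = hamming_weight n y)"

lemma weight_preserving_one: "weight_preserving n (1\<^sub>m (2 ^ n))"
  by (auto simp: weight_preserving_def)

lemma index_mult_mat_sum:
  assumes "A \<in> carrier_mat m m" "B \<in> carrier_mat m m" "x < m" "y < m"
  shows "(A * B) $$ (x, y) = (\<Sum>z<m. A $$ (x, z) * B $$ (z, y))"
  using assms by (auto simp: scalar_prod_def lessThan_atLeast0)

lemma index_mult_mat_vec_sum:
  assumes "A \<in> carrier_mat m m" "v \<in> carrier_vec m" "x < m"
  shows "(A *\<^sub>v v) $ x = (\<Sum>y<m. A $$ (x, y) * v $ y)"
  using assms by (auto simp: scalar_prod_def lessThan_atLeast0)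

lemma weight_preserving_mult:
  assumes "weight_preserving n A" "weight_preserving n B"
  shows "weight_preserving n (A * B)"
proof -
  have c: "A \<in> carrier_mat (2 ^ n) (2 ^ n)" "B \<in> carrier_mat (2 ^ n) (2 ^ n)"
    using assms by (auto simp: weight_preserving_def)
  have "hamming_weight n x = hamming_weight n y"
    if xy: "x < 2 ^ n" "y < 2 ^ n" "(A * B) $$ (x, y) \<noteq> 0" for x y
  proof -
    obtain z where "z < 2 ^ n" "A $$ (x, z) * B $$ (z, y) \<noteq> 0"
      using xy(3) unfolding index_mult_mat_sum[OF c xy(1,2)] by (meson lessThan_iff sum.not_neutral_contains_not_neutral)
    then show ?thesis using assms xy(1,2) unfolding weight_preserving_def
      by (metis mult_zero_left mult_zero_right)
  qed
  then show ?thesis using c unfolding weight_preserving_def by auto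
qed

lemma foldr_mult_weight_preserving:
  assumes "\<And>A. A \<in> set As \<Longrightarrow> weight_preserving n A"
  shows "weight_preserving n (foldr (*) As (1\<^sub>m (2 ^ n)))"
  using assms by (induction As) (auto intro: weight_preserving_one weight_preserving_mult)

text \<open>The gate is diagonal, so a nonzero entry forces equal bits on qubit \<open>i\<close> as
  well as on all others.\<close>

lemma on_qubit_rz_weight_preserving:
  assumes "i < n"
  shows "weight_preserving n (on_qubit n i (rz \<phi>))"
  unfolding weight_preserving_def
proof (intro conjI allI impI)
  show "on_qubit n i (rz \<phi>) \<in> carrier_mat (2 ^ n) (2 ^ n)" by (simp add: on_qubit_def)
next
  fix x y :: nat assume xy: "x < 2 ^ n" "y < 2 ^ n" and nz: "on_qubit n i (rz \<phi>) $$ (x, y) \<noteq> 0"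
  then have eq: "bit x b = bit y b" if "b < n" "b \<noteq> i" for b
    using that by (auto simp: on_qubit_def split: if_splits)
  have "rz \<phi> $$ (of_bool (bit x i), of_bool (bit y i)) \<noteq> 0"
    using xy nz by (auto simp: on_qubit_def split: if_splits)
  then have "bit x i = bit y i"
    by (cases "bit x i"; cases "bit y i") (auto simp: rz_def mat_of_rows_list_def)
  then have "bit x b = bit y b" if "b < n" for b
    using eq that by blast
  then show "hamming_weight n x = hamming_weight n y"
    unfolding hamming_weight_def by metis
qed

text \<open>Columns 00 and 11 of the gate are constant unit vectors, while columns 01 and 10 hold
  only cosines, signed sines and zeros; hence the degree depends on the column \<open>(c, d)\<close>
  alone.\<close>

lemma rbs_entry_trig:
  "\<exists>g. trig (of_bool (c \<noteq> d)) g \<and>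
     (\<forall>\<theta>. rbs \<theta> $$ (2 * of_bool a + of_bool b, 2 * of_bool c + of_bool d) = complex_of_real (g \<theta>))"
proof -
  have E: "rbs \<theta> $$ (2 * of_bool a + of_bool b, 2 * of_bool c + of_bool d) = complex_of_real
     (if c = d then of_bool (a = c \<and> b = d)
      else if a = b then 0 else if a = c then cos \<theta> else if c then sin \<theta> else - sin \<theta>)" for \<theta>
    by (cases a; cases b; cases c; cases d) (simp_all add: rbs_def mat_of_rows_list_def)
  have "trig (of_bool (c \<noteq> d)) (\<lambda>\<theta>. if c = d then of_bool (a = c \<and> b = d)
      else if a = b then 0 else if a = c then cos \<theta> else if c then sin \<theta> else - sin \<theta>)"
    by (cases a; cases b; cases c; cases d)
       (simp_all add: trig_const trig_zero trig_cos trig_sin trig_minus del: One_nat_def)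
  then show ?thesis unfolding E by blast
qed

lemma rbs_entry_nonzero:
  assumes "rbs \<theta> $$ (2 * of_bool a + of_bool b, 2 * of_bool c + of_bool d) \<noteq> 0"
  shows "of_bool a + of_bool b = (of_bool c + of_bool d :: nat)"
  using assms by (cases a; cases b; cases c; cases d) (simp_all add: rbs_def mat_of_rows_list_def)

lemma on_pair_carrier: "on_pair n p A \<in> carrier_mat (2 ^ n) (2 ^ n)"
  by (simp add: on_pair_def split_beta)

lemma on_pair_index:
  assumes "x < 2 ^ n" "y < 2 ^ n"
  shows "on_pair n (i, j) A $$ (x, y) =
    (if \<forall>b<n. b \<noteq> i \<and> b \<noteq> j \<longrightarrow> bit x b = bit y b
     then A $$ (2 * of_bool (bit x i) + of_bool (bit x j), 2 * of_bool (bit y i) + of_bool (bit y j))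
     else 0)"
  using assms by (simp only: on_pair_def prod.case index_mat)

text \<open>The gate conserves the number of ones on its own pair and copies every other
  bit.\<close>

lemma on_pair_rbs_weight_preserving:
  assumes "i < n" "j < n" "i \<noteq> j"
  shows "weight_preserving n (on_pair n (i, j) (rbs \<theta>))"
  unfolding weight_preserving_def
proof (intro conjI allI impI)
  show "on_pair n (i, j) (rbs \<theta>) \<in> carrier_mat (2 ^ n) (2 ^ n)" by (rule on_pair_carrier)
next
  fix x y :: nat assume xy: "x < 2 ^ n" "y < 2 ^ n" and nz: "on_pair n (i, j) (rbs \<theta>) $$ (x, y) \<noteq> 0"
  then have eq: "bit x b = bit y b" if "b < n" "b \<noteq> i" "b \<noteq> j" for b
    using that by (auto simp: on_pair_def split: if_splits)
  have "rbs \<theta> $$ (2 * of_bool (bit x i) + of_bool (bit x j), 2 * of_bool (bit y i) + of_bool (bit y j)) \<noteq> 0"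
    using xy nz by (auto simp: on_pair_def split: if_splits)
  note rbs_entry_nonzero[OF this]
  moreover have hw: "hamming_weight n z = of_bool (bit z i) + of_bool (bit z j) +
      (\<Sum>b\<in>{..<n} - {i} - {j}. of_bool (bit z b))" for z
    unfolding hamming_weight_eq_sum using assms
    by (simp add: sum.remove[of "{..<n}" i] sum.remove[of "{..<n} - {i}" j] del: sum_of_bool_eq)
  moreover have "(\<Sum>b\<in>{..<n} - {i} - {j}. of_bool (bit x b)) = (\<Sum>b\<in>{..<n} - {i} - {j}. of_bool (bit y b) :: nat)"
    using eq by (intro sum.cong) auto
  ultimately show "hamming_weight n x = hamming_weight n y" by simp
qed

lemma rbs_layer_weight_preserving:
  assumes "disjoint_pairs n ps"
  shows "weight_preserving n (rbs_layer n ps v)"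
  unfolding rbs_layer_def
proof (rule foldr_mult_weight_preserving)
  fix A assume "A \<in> set (map (\<lambda>j. on_pair n (ps ! j) (rbs (v j))) [0..<length ps])"
  then obtain j where j: "j < length ps" "A = on_pair n (ps ! j) (rbs (v j))" by auto
  obtain p q where pq: "ps ! j = (p, q)" by (cases "ps ! j")
  then have "(p, q) \<in> set ps" using j(1) by (metis nth_mem)
  then show "weight_preserving n A"
    using assms unfolding j(2) pq disjoint_pairs_def
    by (auto intro!: on_pair_rbs_weight_preserving)
qed

lemma rz_layer_weight_preserving: "weight_preserving n (rz_layer n \<phi>)"
  unfolding rz_layer_def
  by (rule foldr_mult_weight_preserving) (auto intro: on_qubit_rz_weight_preserving)

lemma circuit_weight_preserving:
  assumes "\<forall>l\<in>{1..d}. disjoint_pairs n (P l)"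
  shows "weight_preserving n (circuit n P \<theta> \<phi> d)"
  using assms
  by (induction d)
     (auto intro!: weight_preserving_one weight_preserving_mult rbs_layer_weight_preserving rz_layer_weight_preserving)

section \<open>Isolating one layer of the circuit\<close>

lemma circuit_cong:
  assumes "\<And>l. l \<in> {1..d} \<Longrightarrow> \<theta> l = \<theta>' l"
  shows "circuit n P \<theta> \<phi> d = circuit n P \<theta>' \<phi> d"
  using assms by (induction d) auto

text \<open>Later layers are collected in \<open>A\<close> and earlier ones in \<open>B\<close>. It
  is \<open>B\<close> that acts on the input state, so weight preservation is recorded for it;
  \<open>A\<close> will only supply coefficients.\<close>

lemma circuit_split_layer:
  assumes "\<forall>l\<in>{1..d}. disjoint_pairs n (P l)" "l \<in> {1..d}"
  shows "\<exists>A B. A \<in> carrier_mat (2 ^ n) (2 ^ n) \<and> weight_preserving n B \<and>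
     (\<forall>v. circuit n P (\<theta>(l := v)) \<phi> d = A * rbs_layer n (P l) v * B)"
  using assms
proof (induction d)
  case (Suc d)
  have carrier: "rbs_layer n (P l') v \<in> carrier_mat (2 ^ n) (2 ^ n)" if "l' \<in> {1..Suc d}" for l' v
    using rbs_layer_weight_preserving that Suc.prems(1) by (auto simp: weight_preserving_def)
  have P': "\<forall>l\<in>{1..d}. disjoint_pairs n (P l)" using Suc.prems(1) by auto
  have rz: "weight_preserving n (rz_layer n (\<phi> (Suc d)))"
    by (rule rz_layer_weight_preserving)
  show ?case
  proof (cases "l = Suc d")
    case True
    \<comment> \<open>Within a layer the phase gates act first, so those of layer \<open>l\<close>
      belong to the right factor.\<close>
    let ?B = "rz_layer n (\<phi> (Suc d)) * circuit n P \<theta> \<phi> d"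
    have C: "weight_preserving n (circuit n P \<theta> \<phi> d)"
      using P' by (rule circuit_weight_preserving)
    have "circuit n P (\<theta>(l := v)) \<phi> (Suc d) = 1\<^sub>m (2 ^ n) * rbs_layer n (P l) v * ?B" for v
    proof -
      have "circuit n P (\<theta>(l := v)) \<phi> d = circuit n P \<theta> \<phi> d"
        by (rule circuit_cong) (simp add: True)
      then show ?thesis
        using carrier[of l v] rz C True
        by (simp add: weight_preserving_def assoc_mult_mat[of _ "2 ^ n" "2 ^ n" _ "2 ^ n" _ "2 ^ n"])
    qed
    then show ?thesis using weight_preserving_mult[OF rz C] one_carrier_mat by blast
  next
    case False
    then have "l \<in> {1..d}" using Suc.prems(2) by auto
    then obtain A B where A: "A \<in> carrier_mat (2 ^ n) (2 ^ n)" and B: "weight_preserving n B"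
      and AB: "\<And>v. circuit n P (\<theta>(l := v)) \<phi> d = A * rbs_layer n (P l) v * B"
      using Suc.IH[OF P' \<open>l \<in> {1..d}\<close>] by blast
    let ?L = "rbs_layer n (P (Suc d)) (\<theta> (Suc d)) * rz_layer n (\<phi> (Suc d))"
    have L: "?L \<in> carrier_mat (2 ^ n) (2 ^ n)"
      using rz mult_carrier_mat[OF carrier[of "Suc d"]] by (simp add: weight_preserving_def)
    have "circuit n P (\<theta>(l := v)) \<phi> (Suc d) = ?L * A * rbs_layer n (P l) v * B" for v
      using False L A B carrier[OF Suc.prems(2), of v]
      by (simp add: AB weight_preserving_def assoc_mult_mat[of _ "2 ^ n" "2 ^ n" _ "2 ^ n" _ "2 ^ n"])
    then show ?thesis using mult_carrier_mat[OF L A] B by blast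
  qed
qed simp

section \<open>Entries of an RBS layer as sums of trigonometric products\<close>

lemma trig_span_cong:
  "trig_span N e F \<Longrightarrow> (\<And>i. i < N \<Longrightarrow> e i = f i) \<Longrightarrow> trig_span N f F"
  by (induction rule: trig_span.induct) (auto intro: trig_span.intros)

lemma trig_span_coordinate:
  assumes "trig e g" "j < N"
  shows "trig_span N (\<lambda>i. if i = j then e else 0) (\<lambda>v. g (v j))"
proof -
  have "trig_span N (\<lambda>i. if i = j then e else 0) (\<lambda>v. \<Prod>i<N. (if i = j then g else (\<lambda>_. 1)) (v i))"
    by (rule trig_span_prod) (auto intro: assms(1) trig_const)
  moreover have "(\<Prod>i<N. (if i = j then g else (\<lambda>_. 1)) (v i)) = g (v j)" for v
    using assms(2) by (simp add: if_distribR prod.delta)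
  ultimately show ?thesis by simp
qed

\<comment> \<open>The last clause says that gates on the pairs in \<open>js\<close> do not touch the other qubits; it makes
  the column index of the next gate agree with the input bits.\<close>
lemma rbs_product_entry:
  assumes ps: "disjoint_pairs n ps" and js: "distinct js" "set js \<subseteq> {..<length ps}"
    and z: "z < 2 ^ n" and x: "x < 2 ^ n"
  defines "Q \<equiv> \<lambda>js v. foldr (*) (map (\<lambda>j. on_pair n (ps ! j) (rbs (v j))) js) (1\<^sub>m (2 ^ n))"
  shows "\<exists>F. trig_span (length ps) (\<lambda>i. if i \<in> set js then odd_pair ps x i else 0) F \<and>
     (\<forall>v. Q js v $$ (z, x) = complex_of_real (F v)) \<and>
     ((\<exists>b<n. bit z b \<noteq> bit x b \<and> (\<forall>j\<in>set js. b \<notin> {fst (ps ! j), snd (ps ! j)})) \<longrightarrow> F = (\<lambda>_. 0))"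
  using js z
proof (induction js arbitrary: z)
  case Nil
  have "trig_span (length ps) (\<lambda>_. 0) (\<lambda>v. \<Prod>i<length ps. (\<lambda>_. 1) (v i))"
    by (rule trig_span_prod) (rule trig_const)
  \<comment> \<open>The empty product of gates is the identity; its entries are the constant product
    1 and the zero function.\<close>
  then have "trig_span (length ps) (\<lambda>_. 0) (\<lambda>_. of_bool (z = x))"
    by (cases "z = x") (auto intro: trig_span_zero)
  then show ?case
    using Nil x by (intro exI[of _ "\<lambda>_. of_bool (z = x)"]) (auto simp: Q_def)
next
  case (Cons j js)
  let ?N = "length ps"
  let ?e = "\<lambda>i. if i \<in> set (j # js) then odd_pair ps x i else 0"
  have j: "j < ?N" "j \<notin> set js" "set js \<subseteq> {..<?N}" using Cons.prems by auto
  obtain p q where pq: "ps ! j = (p, q)" by (cases "ps ! j")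
  have "(p, q) \<in> set ps" using j(1) pq by (metis nth_mem)
  then have pqn: "p < n" "q < n" "p \<noteq> q" using ps by (auto simp: disjoint_pairs_def)
  have disj: "b \<notin> {fst (ps ! i), snd (ps ! i)}" if "b \<in> {p, q}" "i \<in> set js" for b i
  proof -
    have "i < ?N" "i \<noteq> j" using that j by auto
    then have "{fst (ps ! i), snd (ps ! i)} \<inter> {fst (ps ! j), snd (ps ! j)} = {}"
      using ps j(1) unfolding disjoint_pairs_def by blast
    then show ?thesis using that(1) pq by auto
  qed
  have Qc: "Q js v \<in> carrier_mat (2 ^ n) (2 ^ n)" for v
    unfolding Q_def by (induction js) (auto intro!: mult_carrier_mat on_pair_carrier)
  let ?bad = "\<exists>b<n. bit z b \<noteq> bit x b \<and> (\<forall>i\<in>set (j # js). b \<notin> {fst (ps ! i), snd (ps ! i)})"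
  have "\<exists>G. trig_span ?N ?e G \<and>
      (\<forall>v. on_pair n (ps ! j) (rbs (v j)) $$ (z, y) * Q js v $$ (y, x) = complex_of_real (G v)) \<and>
      (?bad \<longrightarrow> G = (\<lambda>_. 0))" if y: "y < 2 ^ n" for y
  proof -
    obtain F where F: "trig_span ?N (\<lambda>i. if i \<in> set js then odd_pair ps x i else 0) F"
      "\<And>v. Q js v $$ (y, x) = complex_of_real (F v)"
      "(\<exists>b<n. bit y b \<noteq> bit x b \<and> (\<forall>i\<in>set js. b \<notin> {fst (ps ! i), snd (ps ! i)})) \<Longrightarrow> F = (\<lambda>_. 0)"
      using Cons.IH[OF _ _ y] Cons.prems by auto
    \<comment> \<open>The summand vanishes in the first two cases: either the gates in
      \<open>js\<close> do not lead from \<open>x\<close> to \<open>y\<close>, or the new gate would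
      have to change a bit outside its pair.\<close>
    consider "F = (\<lambda>_. 0)" | "\<not> (\<forall>b<n. b \<noteq> p \<and> b \<noteq> q \<longrightarrow> bit z b = bit y b)"
      | "F \<noteq> (\<lambda>_. 0)" "\<forall>b<n. b \<noteq> p \<and> b \<noteq> q \<longrightarrow> bit z b = bit y b" by blast
    then show ?thesis
    proof cases
      case 1
      then show ?thesis using F(2)
        by (intro exI[of _ "\<lambda>_. 0"]) (auto intro: trig_span_zero)
    next
      case 2
      then have "on_pair n (ps ! j) (rbs t) $$ (z, y) = 0" for t
        by (simp only: pq on_pair_index[OF Cons.prems(3) y] if_False)
      then show ?thesis by (intro exI[of _ "\<lambda>_. 0"]) (auto intro: trig_span_zero)
    next
      case 3
      \<comment> \<open>Contrapositive of the last clause of the induction hypothesis. It covers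
        \<open>p\<close> and \<open>q\<close> because the pairs are disjoint, so the new gate reads
        its column from the bits of \<open>x\<close>.\<close>
      have yx: "bit y b = bit x b" if "b < n" "\<forall>i\<in>set js. b \<notin> {fst (ps ! i), snd (ps ! i)}" for b
        using that F(3) 3(1) by blast
      have ypq: "bit y p = bit x p" "bit y q = bit x q"
        using yx[of p] yx[of q] disj pqn by blast+
      obtain g where g: "trig (of_bool (bit x p \<noteq> bit x q)) g"
        "\<And>t. rbs t $$ (2 * of_bool (bit z p) + of_bool (bit z q),
                  2 * of_bool (bit x p) + of_bool (bit x q)) = complex_of_real (g t)"
        using rbs_entry_trig[of "bit x p" "bit x q" "bit z p" "bit z q"] by blast
      have "on_pair n (ps ! j) (rbs t) $$ (z, y) = complex_of_real (g t)" for t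
        by (simp only: pq on_pair_index[OF Cons.prems(3) y] if_P[OF 3(2)] ypq g(2))
      \<comment> \<open>As \<open>j\<close> is not in \<open>js\<close>, the two degree profiles
        have disjoint supports and add up to \<open>?e\<close>.\<close>
      moreover have "trig_span ?N (\<lambda>i. (if i = j then odd_pair ps x j else 0) +
          (if i \<in> set js then odd_pair ps x i else 0)) (\<lambda>v. g (v j) * F v)"
        using g(1) j(1) F(1) by (intro trig_span_mult trig_span_coordinate) (simp_all add: odd_pair_def pq)
      then have "trig_span ?N ?e (\<lambda>v. g (v j) * F v)"
        by (rule trig_span_cong) (use j(2) in auto)
      moreover have "\<not> ?bad"
        using 3(2) yx pq by auto
      ultimately show ?thesis
        using F(2) by (intro exI[of _ "\<lambda>v. g (v j) * F v"]) auto
    qed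
  qed
  then have "\<forall>y\<in>{..<2 ^ n}. \<exists>G. trig_span ?N ?e G \<and>
      (\<forall>v. on_pair n (ps ! j) (rbs (v j)) $$ (z, y) * Q js v $$ (y, x) = complex_of_real (G v)) \<and>
      (?bad \<longrightarrow> G = (\<lambda>_. 0))" by blast
  from bchoice[OF this] obtain G where G: "\<forall>y\<in>{..<2 ^ n}. trig_span ?N ?e (G y) \<and>
      (\<forall>v. on_pair n (ps ! j) (rbs (v j)) $$ (z, y) * Q js v $$ (y, x) = complex_of_real (G y v)) \<and>
      (?bad \<longrightarrow> G y = (\<lambda>_. 0))" ..
  have "trig_span ?N ?e (\<lambda>v. \<Sum>y<2 ^ n. G y v)"
    by (rule trig_span_sum) (use G in blast)+
  moreover have "Q (j # js) v $$ (z, x) = complex_of_real (\<Sum>y<2 ^ n. G y v)" for v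
  proof -
    have "Q (j # js) v = on_pair n (ps ! j) (rbs (v j)) * Q js v" by (simp add: Q_def)
    then show ?thesis
      using index_mult_mat_sum[OF on_pair_carrier Qc Cons.prems(3) x] G by simp
  qed
  moreover have "?bad \<Longrightarrow> (\<lambda>v. \<Sum>y<2 ^ n. G y v) = (\<lambda>_. 0)"
    using G by simp
  ultimately show ?case by blast
qed

lemma rbs_layer_entry:
  assumes "disjoint_pairs n ps" "z < 2 ^ n" "x < 2 ^ n"
  shows "\<exists>F. trig_span (length ps) (odd_pair ps x) F \<and>
     (\<forall>v. rbs_layer n ps v $$ (z, x) = complex_of_real (F v))"
proof -
  obtain F where "trig_span (length ps) (\<lambda>i. if i \<in> set [0..<length ps] then odd_pair ps x i else 0) F"
    "\<forall>v. rbs_layer n ps v $$ (z, x) = complex_of_real (F v)"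
    using rbs_product_entry[OF assms(1) _ _ assms(2,3), of "[0..<length ps]"]
    unfolding rbs_layer_def by (auto simp: lessThan_atLeast0)
  moreover from this(1) have "trig_span (length ps) (odd_pair ps x) F"
    by (rule trig_span_cong) simp
  ultimately show ?thesis by blast
qed

section \<open>From the input state to the loss\<close>

lemma weight_space_index:
  assumes "\<psi> \<in> weight_space n k" "x < 2 ^ n" "\<psi> $ x \<noteq> 0"
  shows "hamming_weight n x = k"
proof -
  interpret vec_space "TYPE(complex)" "2 ^ n" .
  let ?W = "{unit_vec (2 ^ n) x | x. x < 2 ^ n \<and> hamming_weight n x = k} :: complex vec set"
  obtain a A where A: "\<psi> = lincomb a A" "finite A" "A \<subseteq> ?W"
    using assms(1) in_spanE unfolding weight_space_def by blast
  then have "A \<subseteq> carrier_vec (2 ^ n)" by auto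
  then have "\<psi> $ x = (\<Sum>u\<in>A. a u * u $ x)"
    unfolding A(1) by (rule lincomb_index[OF assms(2)])
  then have "(\<Sum>u\<in>A. a u * u $ x) \<noteq> 0" using assms(3) by simp
  then obtain u where "u \<in> A" "a u * u $ x \<noteq> 0"
    by (rule sum.not_neutral_contains_not_neutral)
  moreover from this(1) obtain y where "u = unit_vec (2 ^ n) y" "y < 2 ^ n" "hamming_weight n y = k"
    using A(3) by auto
  ultimately show ?thesis using assms(2) by (auto split: if_splits)
qed

lemma weight_preserving_mult_vec:
  assumes "weight_preserving n B" "\<psi> \<in> carrier_vec (2 ^ n)"
    and "\<And>x. x < 2 ^ n \<Longrightarrow> \<psi> $ x \<noteq> 0 \<Longrightarrow> hamming_weight n x = k"
    and "x < 2 ^ n" "(B *\<^sub>v \<psi>) $ x \<noteq> 0"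
  shows "hamming_weight n x = k"
proof -
  have B: "B \<in> carrier_mat (2 ^ n) (2 ^ n)" using assms(1) by (simp add: weight_preserving_def)
  obtain y where y: "y < 2 ^ n" "B $$ (x, y) * \<psi> $ y \<noteq> 0"
    using assms(5) unfolding index_mult_mat_vec_sum[OF B assms(2,4)]
    by (meson lessThan_iff sum.not_neutral_contains_not_neutral)
  then have "hamming_weight n x = hamming_weight n y"
    using assms(1,4) unfolding weight_preserving_def by (metis mult_zero_left)
  then show ?thesis using assms(3) y by auto
qed

lemma mat_adjoint_index:
  assumes "A \<in> carrier_mat m m" "i < m" "j < m"
  shows "mat_adjoint A $$ (i, j) = conjugate (A $$ (j, i))"
  using assms by (auto simp: mat_adjoint_def mat_of_rows_def)

lemma mat_adjoint_carrier: "A \<in> carrier_mat m m \<Longrightarrow> mat_adjoint A \<in> carrier_mat m m"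
  by (auto simp: mat_adjoint_def)

text \<open>Moving the adjoint to the other side of the inner product leaves the circuit only in the
  vector \<open>U *\<^sub>v \<psi>\<close>.\<close>

lemma expectation_value_expand:
  fixes U M :: "complex mat"
  assumes U: "U \<in> carrier_mat m m" and M: "M \<in> carrier_mat m m" and \<psi>: "\<psi> \<in> carrier_vec m"
  shows "((mat_adjoint U * M * U) *\<^sub>v \<psi>) \<bullet>c \<psi> =
    (\<Sum>z<m. \<Sum>w<m. M $$ (z, w) * (U *\<^sub>v \<psi>) $ w * cnj ((U *\<^sub>v \<psi>) $ z))"
proof -
  note U' = mat_adjoint_carrier[OF U]
  let ?\<omega> = "U *\<^sub>v \<psi>"
  have \<omega>: "?\<omega> \<in> carrier_vec m" using U \<psi> by simp
  have M\<omega>: "M *\<^sub>v ?\<omega> \<in> carrier_vec m" using M \<omega> by simp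
  have "(mat_adjoint U * M * U) *\<^sub>v \<psi> = mat_adjoint U *\<^sub>v (M *\<^sub>v ?\<omega>)"
    using U' M U \<psi> by (simp add: assoc_mult_mat_vec[of _ m m _ m])
  then have "((mat_adjoint U * M * U) *\<^sub>v \<psi>) \<bullet>c \<psi>
      = (\<Sum>x<m. (\<Sum>z<m. cnj (U $$ (z, x)) * (M *\<^sub>v ?\<omega>) $ z) * cnj (\<psi> $ x))"
    using \<psi> U by (simp add: scalar_prod_def lessThan_atLeast0[symmetric] index_mult_mat_vec_sum[OF U' M\<omega>] mat_adjoint_index
        del: index_mult_mat_vec)
  also have "\<dots> = (\<Sum>z<m. (M *\<^sub>v ?\<omega>) $ z * (\<Sum>x<m. cnj (U $$ (z, x)) * cnj (\<psi> $ x)))"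
    unfolding sum_distrib_right sum_distrib_left by (subst sum.swap) (simp add: algebra_simps)
  also have "\<dots> = (\<Sum>z<m. (M *\<^sub>v ?\<omega>) $ z * cnj (?\<omega> $ z))"
    by (intro sum.cong refl) (simp add: index_mult_mat_vec_sum[OF U \<psi>] del: index_mult_mat_vec)
  also have "\<dots> = (\<Sum>z<m. \<Sum>w<m. M $$ (z, w) * ?\<omega> $ w * cnj (?\<omega> $ z))"
    by (intro sum.cong refl)
       (simp add: index_mult_mat_vec_sum[OF M \<omega>] sum_distrib_right del: index_mult_mat_vec)
  finally show ?thesis .
qed

text \<open>Expanding ket and bra over basis states writes the loss as a linear combination of
  products of two layer entries, and the shift rule is checked term by term.\<close>

lemma loss_exact_shift_rule:
  assumes P: "\<forall>l\<in>{1..d}. disjoint_pairs n (P l)" and l: "l \<in> {1..d}"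
    and cov: "covers_modes n (P l)"
    and \<psi>: "\<psi> \<in> carrier_vec (2 ^ n)" "\<psi> \<in> weight_space n k"
    and M: "M \<in> carrier_mat (2 ^ n) (2 ^ n)"
    and moments: "\<forall>m\<in>{1..k}. (\<Sum>q=1..k. a q * sin (r q) * cos (r q) ^ (2 * m - 1)) = 1 / 2"
  shows "exact_shift_rule (n div 2) k a r (\<lambda>v. loss n P d \<psi> M (\<theta>(l := v)) \<phi>)"
proof -
  let ?m = "2 ^ n :: nat" and ?R = "rbs_layer n (P l)"
  have Pl: "disjoint_pairs n (P l)" using P l by blast
  have N: "length (P l) = n div 2" by (rule length_covering_pairs[OF Pl cov])
  obtain A B where A: "A \<in> carrier_mat ?m ?m" and B: "weight_preserving n B"
    and AB: "\<And>v. circuit n P (\<theta>(l := v)) \<phi> d = A * ?R v * B"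
    using circuit_split_layer[OF P l] by metis
  have Bc: "B \<in> carrier_mat ?m ?m" using B by (simp add: weight_preserving_def)
  have R: "?R v \<in> carrier_mat ?m ?m" for v
    using rbs_layer_weight_preserving[OF Pl] by (simp add: weight_preserving_def)
  \<comment> \<open>Apart from the phases and earlier layers already applied, this is the input
    state; it is what the RBS gates of layer \<open>l\<close> act on, and it still has weight
    \<open>k\<close>.\<close>
  define \<chi> where "\<chi> = B *\<^sub>v \<psi>"
  have \<chi>: "\<chi> \<in> carrier_vec ?m" using Bc \<psi> by (simp add: \<chi>_def)
  have \<chi>k: "hamming_weight n x = k" if "x < ?m" "\<chi> $ x \<noteq> 0" for x
    using weight_preserving_mult_vec[OF B \<psi>(1) weight_space_index[OF \<psi>(2)]] that
    by (simp add: \<chi>_def)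
  obtain F where F: "\<And>u x. u < ?m \<Longrightarrow> x < ?m \<Longrightarrow> trig_span (n div 2) (odd_pair (P l) x) (F u x)"
    "\<And>u x v. u < ?m \<Longrightarrow> x < ?m \<Longrightarrow> ?R v $$ (u, x) = complex_of_real (F u x v)"
    using rbs_layer_entry[OF Pl] unfolding N by metis
  have \<omega>: "((A * ?R v * B) *\<^sub>v \<psi>) $ w
      = (\<Sum>u<?m. \<Sum>x<?m. A $$ (w, u) * (complex_of_real (F u x v) * \<chi> $ x))" if "w < ?m" for w v
  proof -
    have R\<chi>: "?R v *\<^sub>v \<chi> \<in> carrier_vec ?m" by (rule mult_mat_vec_carrier[OF R \<chi>])
    have "(A * ?R v * B) *\<^sub>v \<psi> = A *\<^sub>v (?R v *\<^sub>v \<chi>)"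
      unfolding \<chi>_def using A R Bc \<psi>(1) by (simp add: assoc_mult_mat_vec[of _ ?m ?m _ ?m])
    then show ?thesis
      using that by (simp add: index_mult_mat_vec_sum[OF A R\<chi>] index_mult_mat_vec_sum[OF R \<chi>] F(2)
          sum_distrib_left del: index_mult_mat_vec)
  qed
  \<comment> \<open>The entries of the RBS layer are real, so they can be pulled out of the
    conjugation and of \<open>Re\<close>; everything complex is a constant.\<close>
  let ?c = "\<lambda>z w u x u' x'. Re (M $$ (z, w) * A $$ (w, u) * \<chi> $ x * cnj (A $$ (z, u') * \<chi> $ x'))"
  have L: "loss n P d \<psi> M (\<theta>(l := v)) \<phi> =
      (\<Sum>z<?m. \<Sum>w<?m. \<Sum>u'<?m. \<Sum>x'<?m. \<Sum>u<?m. \<Sum>x<?m. ?c z w u x u' x' * (F u x v * F u' x' v))" for v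
  proof -
    have U: "A * ?R v * B \<in> carrier_mat ?m ?m" using A R Bc by (meson mult_carrier_mat)
    have summand_eq: "Re (M $$ (z, w) * (A $$ (w, u) * (complex_of_real f * \<chi> $ x)) *
          cnj (A $$ (z, u') * (complex_of_real f' * \<chi> $ x'))) = ?c z w u x u' x' * (f * f')"
      for z w u x u' x' f f'
    proof -
      have "M $$ (z, w) * (A $$ (w, u) * (complex_of_real f * \<chi> $ x)) *
          cnj (A $$ (z, u') * (complex_of_real f' * \<chi> $ x')) =
        M $$ (z, w) * A $$ (w, u) * \<chi> $ x * cnj (A $$ (z, u') * \<chi> $ x') * complex_of_real (f * f')"
        by (simp add: algebra_simps)
      then show ?thesis by (simp only:) simp
    qed
    show ?thesis
      unfolding loss_def Let_def AB expectation_value_expand[OF U M \<psi>(1)] Re_sum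
      by (intro sum.cong refl)
         (simp only: \<omega> lessThan_iff cnj_sum sum_distrib_left sum_distrib_right Re_sum summand_eq)
  qed
  have summand: "exact_shift_rule (n div 2) k a r (\<lambda>v. ?c z w u x u' x' * (F u x v * F u' x' v))"
    if u: "u < ?m" "x < ?m" "u' < ?m" "x' < ?m" for z w u x u' x'
  proof (cases "\<chi> $ x = 0 \<or> \<chi> $ x' = 0")
    case True
    then show ?thesis using exact_shift_rule_zero by auto
  next
    case False
    then have k: "hamming_weight n x = k" "hamming_weight n x' = k" using \<chi>k u by auto
    let ?e = "\<lambda>j. odd_pair (P l) x j + odd_pair (P l) x' j"
    \<comment> \<open>The columns \<open>x\<close> and \<open>x'\<close> each contribute at most
      \<open>k\<close>, with the parity of \<open>k\<close>.\<close>
    have "even (\<Sum>j<n div 2. ?e j)" "(\<Sum>j<n div 2. ?e j) \<le> 2 * k"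
      using sum_odd_pair[OF Pl cov, of x] sum_odd_pair[OF Pl cov, of x']
      unfolding k N sum.distrib by (auto simp: even_add)
    moreover have "trig_span (n div 2) ?e (\<lambda>v. F u x v * F u' x' v)"
      using F(1) u by (intro trig_span_mult)
    ultimately show ?thesis
      by (intro exact_shift_rule_cmult trig_span_imp_exact_shift_rule[OF moments])
  qed
  show ?thesis
    unfolding L by (intro exact_shift_rule_sum finite_lessThan summand) auto
qed

subsection \<open>Evaluation points and layouts\<close>

lemma length_evaluation_points: "length (evaluation_points k r v s) = 2 * k"
  by (induction k) (simp_all add: evaluation_points_def)

text \<open>Choosing \<open>h\<close> before \<open>f\<close> and \<open>j\<close> expresses that
  the values at the listed points determine all estimators; \<open>j\<close> enters only through the
  sign \<open>s j\<close>.\<close>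

lemma estimator_from_evaluations:
  "\<exists>h. \<forall>f j. estimator k a r f v s j = h j (map f (evaluation_points k r v s))"
proof -
  \<comment> \<open>Shift \<open>q\<close> occupies positions \<open>2 * (q - 1)\<close> and
    \<open>2 * (q - 1) + 1\<close>, since the list counts from 0 and \<open>q\<close> from 1.
    Appending a shift leaves earlier positions in place.\<close>
  define H where "H k xs = (\<Sum>q=1..k. a q * (xs ! (2 * (q - 1)) - xs ! (2 * (q - 1) + 1)))"
    for k and xs :: "real list"
  have "(\<Sum>q=1..k. a q * (f (\<lambda>i. v i + r q * s i) - f (\<lambda>i. v i - r q * s i)))
      = H k (map f (evaluation_points k r v s))" for f :: "(nat \<Rightarrow> real) \<Rightarrow> real"
  proof (induction k)
    case (Suc k)
    let ?E = "evaluation_points k r v s"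
    have E: "evaluation_points (Suc k) r v s = ?E @
        [\<lambda>i. v i + r (Suc k) * s i, \<lambda>i. v i - r (Suc k) * s i]"
      by (simp add: evaluation_points_def)
    have "H (Suc k) (map f (evaluation_points (Suc k) r v s)) = H k (map f ?E) +
        a (Suc k) * (f (\<lambda>i. v i + r (Suc k) * s i) - f (\<lambda>i. v i - r (Suc k) * s i))"
      unfolding H_def E
      by (auto simp: nth_append length_evaluation_points intro!: sum.cong)
    then show ?case using Suc.IH by simp
  qed (simp add: H_def)
  then show ?thesis
    by (intro exI[of _ "\<lambda>j xs. s j * H k xs"]) (simp add: estimator_def)
qed

section \<open>Butterfly and brick-wall pairings\<close>

lemma nat_less_exp_iff_bit: "(x::nat) < 2 ^ n \<longleftrightarrow> (\<forall>b\<ge>n. \<not> bit x b)"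
proof
  assume "x < 2 ^ n"
  then have "take_bit n x = x" by (simp add: take_bit_nat_eq_self)
  then show "\<forall>b\<ge>n. \<not> bit x b" by (metis bit_take_bit_iff not_less)
next
  assume "\<forall>b\<ge>n. \<not> bit x b"
  then have "take_bit n x = x" by (auto simp: bit_eq_iff bit_take_bit_iff not_less[symmetric])
  then show "x < 2 ^ n" by (simp add: take_bit_nat_eq_self_iff)
qed

text \<open>Flipping bit \<open>l - 1\<close> is an involution without fixed points on the modes;
  the pairs are its orbits, each listed once with the smaller label first.\<close>

lemma butterfly_pairs_valid:
  assumes l: "l \<in> {1..K}"
  shows "disjoint_pairs (2 ^ K) (butterfly_pairs K l) \<and> covers_modes (2 ^ K) (butterfly_pairs K l)"
proof -
  let ?f = "\<lambda>i::nat. flip_bit (l - 1) i"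
  have partner: "(\<forall>b. bit i b \<noteq> bit j b \<longleftrightarrow> b = l - 1) \<longleftrightarrow> j = ?f i" for i j :: nat
    by (auto simp: bit_eq_iff bit_flip_bit_iff)
  have ff: "?f (?f i) = i" for i
    by (auto simp: bit_eq_iff bit_flip_bit_iff)
  have lt: "?f i < 2 ^ K" if "i < 2 ^ K" for i
    using that l by (auto simp: nat_less_exp_iff_bit bit_flip_bit_iff)
  have neq: "?f i \<noteq> i" for i
    by (metis partner)
  have set: "set (butterfly_pairs K l) = {(i, j). i < 2 ^ K \<and> j < 2 ^ K \<and> i < j \<and> j = ?f i}"
    unfolding butterfly_pairs_def partner by auto
  \<comment> \<open>\<open>disjoint_pairs\<close> compares positions, whereas the orbit argument
    compares values; distinctness connects the two.\<close>
  have dist: "distinct (butterfly_pairs K l)"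
    unfolding butterfly_pairs_def by (intro distinct_filter distinct_product) auto
  have disj: "{fst x, snd x} \<inter> {fst y, snd y} = {}"
    if "x \<in> set (butterfly_pairs K l)" "y \<in> set (butterfly_pairs K l)" "x \<noteq> y" for x y
    using that ff unfolding set by (auto; metis less_asym)
  have "disjoint_pairs (2 ^ K) (butterfly_pairs K l)"
    unfolding disjoint_pairs_def
  proof (intro conjI allI impI)
    show "\<forall>(i, j)\<in>set (butterfly_pairs K l). i < 2 ^ K \<and> j < 2 ^ K \<and> i \<noteq> j"
      by (auto simp: set)
  next
    fix p q
    assume "p < length (butterfly_pairs K l)" "q < length (butterfly_pairs K l)" "p \<noteq> q"
    then show "{fst (butterfly_pairs K l ! p), snd (butterfly_pairs K l ! p)} \<inter>
        {fst (butterfly_pairs K l ! q), snd (butterfly_pairs K l ! q)} = {}"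
      using dist by (intro disj) (simp_all add: nth_eq_iff_index_eq)
  qed
  moreover have "m \<in> (\<Union>(i, j)\<in>set (butterfly_pairs K l). {i, j})" if "m < 2 ^ K" for m
  proof (cases "m < ?f m")
    case True
    then have "(m, ?f m) \<in> set (butterfly_pairs K l)" using that lt[of m] unfolding set by auto
    then show ?thesis by blast
  next
    case False
    then have "?f m < m" using neq[of m] by simp
    then have "(?f m, m) \<in> set (butterfly_pairs K l)" using that lt[of m] ff[of m] unfolding set by auto
    then show ?thesis by blast
  qed
  then have "covers_modes (2 ^ K) (butterfly_pairs K l)"
    unfolding covers_modes_def using set by auto
  ultimately show ?thesis ..
qed

lemma brick_wall_pairs_valid:
  assumes n: "even n"
  shows "disjoint_pairs n (brick_wall_pairs n c) \<and> covers_modes n (brick_wall_pairs n c)"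
proof -
  obtain N where N: "n = 2 * N" using n by auto
  show ?thesis
  proof (cases "odd c")
    case True
    then have bw: "brick_wall_pairs n c = map (\<lambda>j. (2 * j, 2 * j + 1)) [0..<N]"
      by (simp add: brick_wall_pairs_def N)
    have "m \<in> (\<Union>j<N. {2 * j, 2 * j + 1})" if "m < 2 * N" for m
      using that by (intro UN_I[of "m div 2"]) auto
    then have "covers_modes n (brick_wall_pairs n c)"
      unfolding bw covers_modes_def unfolding N by (auto simp: lessThan_atLeast0)
    moreover have "disjoint_pairs n (brick_wall_pairs n c)"
      unfolding bw disjoint_pairs_def unfolding N by auto
    ultimately show ?thesis by simp
  next
    case False
    \<comment> \<open>Resolves the reduction modulo \<open>n\<close>, which wraps only at the last
      index.\<close>
    define w where "w j = (if Suc j = N then 0 else 2 * j + 2)" for j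
    have bw: "brick_wall_pairs n c = map (\<lambda>j. (2 * j + 1, w j)) [0..<N]"
      using False by (auto simp: brick_wall_pairs_def N w_def)
    have "m \<in> (\<Union>j<N. {2 * j + 1, w j})" if "m < 2 * N" for m
    proof (cases "m = 0")
      case True
      \<comment> \<open>Mode 0 is reached by the wrap-around pair.\<close>
      then show ?thesis using that by (intro UN_I[of "N - 1"]) (auto simp: w_def)
    next
      case False
      then show ?thesis using that
        by (intro UN_I[of "(m - 1) div 2"]) (cases "even m", auto simp: w_def elim!: evenE oddE)
    qed
    moreover have w_lt: "w j < 2 * N" if "j < N" for j
      using that by (auto simp: w_def)
    ultimately have "covers_modes n (brick_wall_pairs n c)"
      unfolding bw covers_modes_def unfolding N by (auto simp: lessThan_atLeast0)
    \<comment> \<open>First components are odd and second ones even, so a clash could occur only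
      between components of the same kind.\<close>
    moreover have "even (w j)" for j by (simp add: w_def)
    then have ne: "w i \<noteq> Suc (2 * j)" "Suc (2 * j) \<noteq> w i" for i j by (metis even_Suc even_mult_iff even_numeral)+
    have "disjoint_pairs n (brick_wall_pairs n c)"
      unfolding bw disjoint_pairs_def unfolding N using w_lt ne
      by (auto simp: w_def split: if_splits)
    ultimately show ?thesis by simp
  qed
qed

section \<open>Expectation over the sign vectors\<close>

lemma finite_sign_vectors: "finite (sign_vectors N)"
  unfolding sign_vectors_def by (intro finite_PiE) auto

lemma card_sign_vectors: "card (sign_vectors N) = 2 ^ N"
  unfolding sign_vectors_def by (simp add: card_PiE numeral_2_eq_2)

lemma expectation_sign_vectors:
  fixes f :: "(nat \<Rightarrow> real) \<Rightarrow> real"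
  shows "measure_pmf.expectation (pmf_of_set (sign_vectors N)) f = (\<Sum>s\<in>sign_vectors N. f s) / 2 ^ N"
proof -
  \<comment> \<open>\<open>pmf_of_set\<close> is the uniform distribution only on a nonempty finite
    set.\<close>
  have "sign_vectors N \<noteq> {}" using card_sign_vectors[of N] by auto
  then show ?thesis by (simp add: integral_pmf_of_set finite_sign_vectors card_sign_vectors)
qed

theorem theorem24:
  shows
    "(\<forall>(n::nat) (k::nat) (d::nat) (l::nat) (P :: nat \<Rightarrow> (nat \<times> nat) list)
        (\<theta> :: nat \<Rightarrow> nat \<Rightarrow> real) (\<phi> :: nat \<Rightarrow> nat \<Rightarrow> real) (\<psi> :: complex vec) (M :: complex mat)
        (a :: nat \<Rightarrow> real) (r :: nat \<Rightarrow> real).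
        even n \<longrightarrow>
        (\<forall>l'\<in>{1..d}. disjoint_pairs n (P l')) \<longrightarrow>
        l \<in> {1..d} \<longrightarrow>
        covers_modes n (P l) \<longrightarrow>
        quantum_state n \<psi> \<longrightarrow>
        \<psi> \<in> weight_space n k \<longrightarrow>
        observable n M \<longrightarrow>
        particle_number_preserving n M \<longrightarrow>
        (\<forall>m\<in>{1..k}. (\<Sum>q=1..k. a q * sin (r q) * cos (r q) ^ (2 * m - 1)) = 1 / 2) \<longrightarrow>
        (let L = (\<lambda>v. loss n P d \<psi> M (\<theta>(l := v)) \<phi>) in
           (\<forall>j < n div 2.
              ((\<lambda>t. L ((\<theta> l)(j := t))) has_real_derivative
                 measure_pmf.expectation (pmf_of_set (sign_vectors (n div 2)))
                   (\<lambda>s. estimator k a r L (\<theta> l) s j)) (at (\<theta> l j))) \<and>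
           (\<forall>s \<in> sign_vectors (n div 2).
              length (evaluation_points k r (\<theta> l) s) = 2 * k \<and>
              (\<exists>h :: nat \<Rightarrow> real list \<Rightarrow> real.
                 \<forall>f :: (nat \<Rightarrow> real) \<Rightarrow> real. \<forall>j < n div 2.
                   estimator k a r f (\<theta> l) s j = h j (map f (evaluation_points k r (\<theta> l) s)))))) \<and>
     (\<forall>(K::nat). \<forall>l\<in>{1..K}.
        disjoint_pairs (2 ^ K) (butterfly_pairs K l) \<and> covers_modes (2 ^ K) (butterfly_pairs K l)) \<and>
     (\<forall>(n::nat). even n \<longrightarrow> (\<forall>c\<in>{1..n}.
        disjoint_pairs n (brick_wall_pairs n c) \<and> covers_modes n (brick_wall_pairs n c)))"
proof (intro conjI allI impI ballI)
  fix n k d l :: nat and P :: "nat \<Rightarrow> (nat \<times> nat) list" and \<theta> \<phi> :: "nat \<Rightarrow> nat \<Rightarrow> real"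
    and \<psi> :: "complex vec" and M :: "complex mat" and a r :: "nat \<Rightarrow> real"
  assume "\<forall>l'\<in>{1..d}. disjoint_pairs n (P l')" "l \<in> {1..d}" "covers_modes n (P l)"
    "quantum_state n \<psi>" "\<psi> \<in> weight_space n k" "observable n M"
    "\<forall>m\<in>{1..k}. (\<Sum>q=1..k. a q * sin (r q) * cos (r q) ^ (2 * m - 1)) = 1 / 2"
  \<comment> \<open>The rule holds at every angle vector; the goal is its instance at
    \<open>\<theta> l\<close>, with the expectation rewritten as a finite average.\<close>
  then have rule: "exact_shift_rule (n div 2) k a r (\<lambda>v. loss n P d \<psi> M (\<theta>(l := v)) \<phi>)"
    unfolding quantum_state_def observable_def by (intro loss_exact_shift_rule) blast+
  show "let L = (\<lambda>v. loss n P d \<psi> M (\<theta>(l := v)) \<phi>) in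
      (\<forall>j < n div 2.
         ((\<lambda>t. L ((\<theta> l)(j := t))) has_real_derivative
            measure_pmf.expectation (pmf_of_set (sign_vectors (n div 2)))
              (\<lambda>s. estimator k a r L (\<theta> l) s j)) (at (\<theta> l j))) \<and>
      (\<forall>s \<in> sign_vectors (n div 2).
         length (evaluation_points k r (\<theta> l) s) = 2 * k \<and>
         (\<exists>h :: nat \<Rightarrow> real list \<Rightarrow> real.
            \<forall>f :: (nat \<Rightarrow> real) \<Rightarrow> real. \<forall>j < n div 2.
              estimator k a r f (\<theta> l) s j = h j (map f (evaluation_points k r (\<theta> l) s))))"
    unfolding Let_def expectation_sign_vectors
  proof (intro conjI allI impI ballI)
    fix s
    show "\<exists>h :: nat \<Rightarrow> real list \<Rightarrow> real.
        \<forall>f :: (nat \<Rightarrow> real) \<Rightarrow> real. \<forall>j < n div 2.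
          estimator k a r f (\<theta> l) s j = h j (map f (evaluation_points k r (\<theta> l) s))"
      using estimator_from_evaluations[of k a r "\<theta> l" s] by blast
  qed (simp_all add: rule[unfolded exact_shift_rule_def] length_evaluation_points del: fun_upd_apply)
qed (use butterfly_pairs_valid brick_wall_pairs_valid in blast)+

end
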